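(* Let $(X,d)$ be a metric space, let $F:X\to\mathbb{K}(X)$ be a continuous multivalued map, and let $A^*$ be a strict attractor of $F$. Then $A^*$ is an asymptotically stable fixed point of the induced operator $F:\mathbb{K}(X)\to\mathbb{K}(X)$ in the metric space $(\mathbb{K}(X),d_H)$.
   Context: For a metric space $(X,d)$ (or a subset $U\subset X$), $\mathbb{K}(X)$ (resp. $\mathbb{K}(U)$) denotes the set of nonempty compact subsets of $X$ (resp. of $U$), endowed with the Hausdorff metric $d_H(A,B)=\max\{\sup_{a\in A}\inf_{b\in B}d(a,b),\ \sup_{b\in B}\inf_{a\in A}d(a,b)\}$. A multivalued map is a map $F:X\to\mathbb{K}(X)$; continuity is with respect to $d$ and $d_H$. It induces the operator $F:\mathbb{K}(X)\to\mathbb{K}(X)$, $F(A)=\bigcup_{x\in A}F(x)$, denoted by the same letter; $F^n$ denotes its $n$-th iterate. Strict attractor: a nonempty compact set $A^*\subset X$ is a strict attractor of $F$ if there exists an open set $U\subset X$ with $U\supset A^*$ such that for all $S\in\mathbb{K}(U)$, $F^n(S)\to A^*$ in $d_H$ as $n\to\infty$. Stable: the fixed point $A^*$ is stable if for every $\epsilon>0$ there is $\delta>0$ such that $d_H(F^n(B),A^* )<\epsilon$ for all $n\in\mathbb{N}$ and all $B\in\mathbb{K}(X)$ with $d_H(B,A^* )<\delta$. Asymptotically stable: $A^*$ is stable and attractive, where attractive means that $\lim_{n\to\infty}d_H(F^n(B),A^* )=0$ for all $B$ in some open neighbourhood of $A^*$ in $(\mathbb{K}(X),d_H)$. *)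

theory Defs
  imports "HOL-Analysis.Analysis"
begin

typedef (overloaded) 'a hyperspace = "{S :: 'a::metric_space set. S \<noteq> {} \<and> compact S}"
  morphisms points Compact
  by (rule exI[of _ "{undefined}"]) simp

lemma points_nonempty [simp]: "points A \<noteq> {}"
  and compact_points [simp]: "compact (points A)"
  using points[of A] by auto

lemma infdist_points_attained:
  obtains c where "c \<in> points C" "infdist a (points C) = dist a c"
proof -
  have "continuous_on (points C) (dist a)"
    by (intro continuous_intros)
  then obtain c where c: "c \<in> points C" "\<And>y. y \<in> points C \<Longrightarrow> dist a c \<le> dist a y"
    using continuous_attains_inf[OF compact_points[of C] points_nonempty, of "dist a"] by blast
  then have "dist a c \<le> infdist a (points C)"
    by (auto simp: infdist_def intro!: cINF_greatest)
  with c that infdist_le show ?thesis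
    by (metis order_antisym)
qed

text \<open>The real-valued suprema and infima are only meaningful for nonempty bounded
  arguments; this function is only used on nonempty compact sets.\<close>

definition hausdorff_dist :: "'a::metric_space set \<Rightarrow> 'a set \<Rightarrow> real" where
  "hausdorff_dist A B =
    max (SUP a\<in>A. INF b\<in>B. dist a b) (SUP b\<in>B. INF a\<in>A. dist a b)"

lemma hausdorff_dist_le_iff:
  assumes AB: "A \<noteq> {}" "compact A" "B \<noteq> {}" "compact B"
  shows "hausdorff_dist A B \<le> r \<longleftrightarrow>
    (\<forall>a\<in>A. infdist a B \<le> r) \<and> (\<forall>b\<in>B. infdist b A \<le> r)"
proof -
  have bdd: "bdd_above ((\<lambda>x. infdist x T) ` S)" if "compact S" for S T :: "'a set"
    by (intro bounded_imp_bdd_above compact_imp_bounded compact_continuous_image that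
        continuous_intros)
  have "hausdorff_dist A B = max (SUP a\<in>A. infdist a B) (SUP b\<in>B. infdist b A)"
    using AB by (simp add: hausdorff_dist_def infdist_def dist_commute)
  then show ?thesis
    using AB by (simp add: cSUP_le_iff[OF _ bdd])
qed

instantiation hyperspace :: (metric_space) metric_space
begin

definition dist_hyperspace_def: "dist A B = hausdorff_dist (points A) (points B)"

definition uniformity_hyperspace_def:
  "(uniformity :: ('a hyperspace \<times> 'a hyperspace) filter) =
    (INF e\<in>{0<..}. principal {(x, y). dist x y < e})"

definition open_hyperspace_def:
  "open (U :: 'a hyperspace set) \<longleftrightarrow>
    (\<forall>x\<in>U. \<forall>\<^sub>F (x', y) in uniformity. x' = x \<longrightarrow> y \<in> U)"

instance
proof
  fix A B C :: "'a hyperspace"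
  have le_iff: "dist A B \<le> r \<longleftrightarrow>
      (\<forall>a\<in>points A. infdist a (points B) \<le> r) \<and> (\<forall>b\<in>points B. infdist b (points A) \<le> r)"
    for A B :: "'a hyperspace" and r
    by (simp add: dist_hyperspace_def hausdorff_dist_le_iff)
  have le1: "infdist a (points B) \<le> dist A B" if "a \<in> points A" for a and A B :: "'a hyperspace"
    using le_iff that by blast
  have comm: "dist A B = dist B A" for A B :: "'a hyperspace"
    by (simp add: dist_hyperspace_def hausdorff_dist_def dist_commute max.commute)
  have nonneg: "0 \<le> dist A B"
    using le1[of _ A B] points_nonempty[of A] infdist_nonneg order_trans by blast
  have "dist A B = 0 \<longleftrightarrow> dist A B \<le> 0"
    using nonneg by linarith
  also have "\<dots> \<longleftrightarrow> points A \<subseteq> points B \<and> points B \<subseteq> points A"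
    unfolding le_iff
    using in_closed_iff_infdist_zero[OF compact_imp_closed[OF compact_points] points_nonempty]
    by (auto simp: subset_iff infdist_nonneg order_antisym_conv)
  also have "\<dots> \<longleftrightarrow> A = B"
    by (simp add: set_eq_subset flip: points_inject)
  finally show "dist A B = 0 \<longleftrightarrow> A = B" .
  have half: "infdist a (points B) \<le> dist A C + dist C B"
    if a: "a \<in> points A" for a and A B C :: "'a hyperspace"
  proof -
    obtain c where c: "c \<in> points C" "infdist a (points C) = dist a c"
      by (rule infdist_points_attained)
    have "infdist a (points B) \<le> infdist c (points B) + dist a c"
      by (rule infdist_triangle)
    then show ?thesis
      using le1[OF a, of C] le1[OF c(1), of B] c(2) by linarith
  qed
  have "infdist b (points A) \<le> dist A C + dist B C" if "b \<in> points B" for b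
    using half[OF that, of A C] comm[of A C] by linarith
  moreover have "infdist a (points B) \<le> dist A C + dist B C" if "a \<in> points A" for a
    using half[OF that, of B C] comm[of B C] by linarith
  ultimately show "dist A B \<le> dist A C + dist B C"
    unfolding le_iff by blast
qed (rule uniformity_hyperspace_def open_hyperspace_def)+

end

definition induced :: "('a::metric_space \<Rightarrow> 'a hyperspace) \<Rightarrow> 'a hyperspace \<Rightarrow> 'a hyperspace" where
  "induced F A = Compact (\<Union>x\<in>points A. points (F x))"

text \<open>For continuous \<open>F\<close> the union is compact, so \<^const>\<open>induced\<close> is the intended operator;
  otherwise its value may be unspecified.\<close>

lemma compact_UN_points:
  fixes F :: "'a::metric_space \<Rightarrow> 'b::metric_space hyperspace"
  assumes "continuous_on S F" "compact S"
  shows "compact (\<Union>x\<in>S. points (F x))"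
proof (rule compactI)
  fix \<C> assume op: "\<forall>V\<in>\<C>. open V" and cov: "(\<Union>x\<in>S. points (F x)) \<subseteq> \<Union>\<C>"
  have "\<exists>V. open V \<and> x \<in> V \<and>
      (\<exists>\<D>. \<D> \<subseteq> \<C> \<and> finite \<D> \<and> (\<forall>y\<in>S \<inter> V. points (F y) \<subseteq> \<Union>\<D>))" if x: "x \<in> S" for x
  proof -
    have "points (F x) \<subseteq> \<Union>\<C>"
      using cov x by blast
    then obtain \<D> where \<D>: "\<D> \<subseteq> \<C>" "finite \<D>" "points (F x) \<subseteq> \<Union>\<D>"
      using compactE[OF compact_points] op by metis
    have "open (\<Union>\<D>)"
      using \<D> op by blast
    then obtain e where e: "e > 0" "(\<Union>z\<in>points (F x). ball z e) \<subseteq> \<Union>\<D>"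
      using compact_subset_open_imp_ball_epsilon_subset[OF compact_points _ \<D>(3)] by metis
    obtain d where d: "d > 0" "\<And>y. y \<in> S \<Longrightarrow> dist y x < d \<Longrightarrow> dist (F y) (F x) < e"
      using assms(1) x e(1) unfolding continuous_on_iff by metis
    have "points (F y) \<subseteq> \<Union>\<D>" if y: "y \<in> S \<inter> ball x d" for y
    proof
      fix z assume z: "z \<in> points (F y)"
      have "infdist z (points (F x)) \<le> dist (F y) (F x)"
        using z hausdorff_dist_le_iff[of "points (F y)" "points (F x)" "dist (F y) (F x)"]
        by (simp add: dist_hyperspace_def)
      also have "\<dots> < e"
        using d(2)[of y] y by (simp add: dist_commute)
      finally have lt: "infdist z (points (F x)) < e" .
      obtain w where "w \<in> points (F x)" "infdist z (points (F x)) = dist z w"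
        by (rule infdist_points_attained)
      with lt have "w \<in> points (F x)" "dist z w < e"
        by simp_all
      then show "z \<in> \<Union>\<D>"
        using e(2) by (meson UN_I mem_ball dist_commute_lessI subsetD)
    qed
    moreover have "open (ball x d)" "x \<in> ball x d"
      using d(1) by auto
    ultimately show ?thesis
      using \<D> by blast
  qed
  then obtain V \<D> where V: "\<And>x. x \<in> S \<Longrightarrow> open (V x) \<and> x \<in> V x"
    and \<D>: "\<And>x. x \<in> S \<Longrightarrow> \<D> x \<subseteq> \<C> \<and> finite (\<D> x) \<and> (\<forall>y\<in>S \<inter> V x. points (F y) \<subseteq> \<Union>(\<D> x))"
    by metis
  have "S \<subseteq> (\<Union>x\<in>S. V x)"
    using V by blast
  then obtain T where T: "T \<subseteq> S" "finite T" "S \<subseteq> (\<Union>x\<in>T. V x)"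
    using compactE_image[OF assms(2), of S V] V by metis
  have "(\<Union>x\<in>T. \<D> x) \<subseteq> \<C>"
    using T(1) \<D> by blast
  moreover have "finite (\<Union>x\<in>T. \<D> x)"
    using T \<D> by (intro finite_UN_I) auto
  moreover have "(\<Union>x\<in>S. points (F x)) \<subseteq> \<Union>(\<Union>x\<in>T. \<D> x)"
  proof
    fix z assume "z \<in> (\<Union>x\<in>S. points (F x))"
    then obtain y where y: "y \<in> S" "z \<in> points (F y)" by blast
    then obtain x where x: "x \<in> T" "y \<in> V x" using T by blast
    then have "points (F y) \<subseteq> \<Union>(\<D> x)" using \<D> T y by blast
    then show "z \<in> \<Union>(\<Union>x\<in>T. \<D> x)" using x y by blast
  qed
  ultimately show "\<exists>\<C>'\<subseteq>\<C>. finite \<C>' \<and> (\<Union>x\<in>S. points (F x)) \<subseteq> \<Union>\<C>'"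
    by blast
qed

lemma points_induced:
  assumes "continuous_on UNIV F"
  shows "points (induced F A) = (\<Union>x\<in>points A. points (F x))"
  unfolding induced_def
  by (rule Compact_inverse)
    (simp add: compact_UN_points[OF continuous_on_subset[OF assms subset_UNIV]])

definition strict_attractor :: "('a::metric_space \<Rightarrow> 'a hyperspace) \<Rightarrow> 'a hyperspace \<Rightarrow> bool" where
  "strict_attractor F A \<longleftrightarrow>
    (\<exists>U. open U \<and> points A \<subseteq> U \<and>
      (\<forall>S. points S \<subseteq> U \<longrightarrow> (\<lambda>n. (induced F ^^ n) S) \<longlonglongrightarrow> A))"

definition stable :: "('a::metric_space \<Rightarrow> 'a hyperspace) \<Rightarrow> 'a hyperspace \<Rightarrow> bool" where
  "stable F A \<longleftrightarrow>
    (\<forall>\<epsilon>>0. \<exists>\<delta>>0. \<forall>n B. dist B A < \<delta> \<longrightarrow> dist ((induced F ^^ n) B) A < \<epsilon>)"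

definition attractive :: "('a::metric_space \<Rightarrow> 'a hyperspace) \<Rightarrow> 'a hyperspace \<Rightarrow> bool" where
  "attractive F A \<longleftrightarrow>
    (\<exists>V. open V \<and> A \<in> V \<and> (\<forall>B\<in>V. (\<lambda>n. dist ((induced F ^^ n) B) A) \<longlonglongrightarrow> 0))"

definition asymptotically_stable ::
    "('a::metric_space \<Rightarrow> 'a hyperspace) \<Rightarrow> 'a hyperspace \<Rightarrow> bool" where
  "asymptotically_stable F A \<longleftrightarrow> stable F A \<and> attractive F A"

end

theory Submission
  imports Defs
begin

text \<open>
  Write \<open>orbit F n x\<close> for \<open>F\<^sup>n({x})\<close>. The induced operator is continuous, so the limit \<open>A\<close> of its
  own iterates is a fixed point, and every \<open>B\<close> Hausdorff-close to \<open>A\<close> lies in the basin \<open>U\<close>;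
  this settles invariance and attractivity. Stability splits into the two halves of the Hausdorff
  distance.

  Upper half (\<open>attractor_upper_stable\<close>): iterates of points near \<open>A\<close> never leave a neighbourhood of
  \<open>A\<close>. If points \<open>y k\<close> approaching \<open>A\<close> violated this at times \<open>n k\<close>, then \<open>S = A \<union> {y k}\<close> would be
  a compact subset of the basin. Since \<open>F\<^sup>n(S)\<close> converges to \<open>A\<close> and contains all \<open>orbit F n (y k)\<close>,
  the times \<open>n k\<close> are bounded; but finitely many iterates are controlled by continuity alone.

  Lower half (\<open>attractor_lower_uniform\<close>): there is one time \<open>M\<close> at which the orbit of every point of
  \<open>A\<close> is \<open>\<epsilon>\<close>-dense in \<open>A\<close>. Pointwise this is the attractor property, but \<open>M\<close> depends on the point. By
  Baire's theorem on the compact set \<open>A\<close>, one time \<open>N\<close> works on some ball of \<open>A\<close>, for all times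
  \<open>n \<ge> N\<close>; and by compactness all orbits in \<open>A\<close> visit that ball within a bounded time.
  Continuity of the \<open>M\<close>-th iterate extends \<open>\<epsilon>\<close>-density at time \<open>M\<close> to all points near \<open>A\<close>.

  If now \<open>B\<close> is close to \<open>A\<close> and \<open>n \<ge> M\<close>, the set \<open>F\<^bsup>n - M\<^esup>(B)\<close> still contains a point near \<open>A\<close> by
  the upper half, so that \<open>F\<^sup>n(B)\<close> is \<open>\<epsilon>\<close>-dense in \<open>A\<close>. The finitely many \<open>n < M\<close> are again a
  matter of continuity.
\<close>

section \<open>Distances in the hyperspace\<close>

lemma dist_hyperspace_le_iff:
  "dist A B \<le> r \<longleftrightarrow>
    (\<forall>a\<in>points A. infdist a (points B) \<le> r) \<and> (\<forall>b\<in>points B. infdist b (points A) \<le> r)"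
  by (simp add: dist_hyperspace_def hausdorff_dist_le_iff)

lemma infdist_points_le_dist:
  assumes "a \<in> points A"
  shows "infdist a (points B) \<le> dist A B"
  using dist_hyperspace_le_iff[of A B "dist A B"] assms by blast

lemma infdist_points_less_iff:
  "infdist x (points A) < r \<longleftrightarrow> (\<exists>a\<in>points A. dist x a < r)"
proof
  assume "infdist x (points A) < r"
  moreover obtain a where "a \<in> points A" "infdist x (points A) = dist x a"
    by (rule infdist_points_attained)
  ultimately show "\<exists>a\<in>points A. dist x a < r" by auto
qed (auto intro: order_le_less_trans[OF infdist_le])

lemma infdist_points_triangle:
  "infdist x (points B) \<le> infdist x (points A) + dist A B"
proof -
  obtain a where a: "a \<in> points A" "infdist x (points A) = dist x a"
    by (rule infdist_points_attained)
  show ?thesis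
    using infdist_triangle[of x "points B" a] infdist_points_le_dist[OF a(1), of B] a(2) by linarith
qed

lemma points_Compact: "S \<noteq> {} \<Longrightarrow> compact S \<Longrightarrow> points (Compact S) = S"
  by (rule Compact_inverse) simp

section \<open>Continuity near compact sets\<close>

text \<open>Only one of the two points is required to lie in the compact set, in contrast to uniform
  continuity on that set.\<close>

lemma continuous_uniform_near_compact:
  fixes f :: "'a::metric_space \<Rightarrow> 'b::metric_space"
  assumes cont: "continuous_on UNIV f" and K: "compact K" and e: "e > 0"
  obtains d where "d > 0" "\<And>x y. x \<in> K \<Longrightarrow> dist x y < d \<Longrightarrow> dist (f x) (f y) < e"
proof -
  define \<G> where "\<G> = range (\<lambda>x. f -` ball (f x) (e/2))"
  have "open G" if "G \<in> \<G>" for G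
    using that cont by (auto simp: \<G>_def intro: open_vimage)
  moreover have "K \<subseteq> \<Union>\<G>"
  proof
    fix x
    have "x \<in> f -` ball (f x) (e/2)" using e by simp
    then show "x \<in> \<Union>\<G>" unfolding \<G>_def by blast
  qed
  ultimately obtain d where d: "d > 0" "\<And>x. x \<in> K \<Longrightarrow> \<exists>G\<in>\<G>. ball x d \<subseteq> G"
    using Heine_Borel_lemma[OF K] by metis
  show ?thesis
  proof (rule that[OF d(1)])
    fix x y assume "x \<in> K" "dist x y < d"
    then obtain c where "ball x d \<subseteq> f -` ball (f c) (e/2)"
      using d(2)[of x] unfolding \<G>_def by blast
    moreover have "x \<in> ball x d" "y \<in> ball x d"
      using \<open>dist x y < d\<close> d(1) by auto
    ultimately have "f x \<in> ball (f c) (e/2)" "f y \<in> ball (f c) (e/2)"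
      by blast+
    then have "dist (f c) (f x) < e/2" "dist (f c) (f y) < e/2"
      unfolding mem_ball by blast+
    then show "dist (f x) (f y) < e"
      by (rule dist_triangle_half_r)
  qed
qed

lemma infdist_less_subset_open:
  assumes "open U" "points A \<subseteq> U"
  shows "\<exists>d>0. \<forall>x. infdist x (points A) < d \<longrightarrow> x \<in> U"
proof -
  obtain d where d: "d > 0" "(\<Union>x\<in>points A. ball x d) \<subseteq> U"
    using compact_subset_open_imp_ball_epsilon_subset[OF compact_points assms] .
  have "x \<in> U" if "infdist x (points A) < d" for x
    using that d(2) by (fastforce simp: infdist_points_less_iff dist_commute)
  with d(1) show ?thesis by blast
qed

text \<open>Finitely many members of an open cover already cover \<open>A\<close>, hence a neighbourhood of \<open>A\<close>,
  hence all but finitely many terms of the sequence.\<close>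

lemma compact_Un_range_approaching:
  assumes lim: "(\<lambda>k. infdist (y k) (points A)) \<longlonglongrightarrow> 0"
  shows "compact (points A \<union> range y)"
proof (rule compactI)
  fix \<C> assume op: "\<forall>V\<in>\<C>. open V" and cov: "points A \<union> range y \<subseteq> \<Union>\<C>"
  obtain \<D> where \<D>: "\<D> \<subseteq> \<C>" "finite \<D>" "points A \<subseteq> \<Union>\<D>"
    by (rule compactE[OF compact_points[of A], of \<C>]) (use op cov in auto)
  have open_\<D>: "open (\<Union>\<D>)" using op \<D>(1) by blast
  obtain d where d: "d > 0" "\<And>x. infdist x (points A) < d \<Longrightarrow> x \<in> \<Union>\<D>"
    using infdist_less_subset_open[OF open_\<D> \<D>(3)] by metis
  obtain m where m: "\<And>k. k \<ge> m \<Longrightarrow> infdist (y k) (points A) < d"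
    using order_tendstoD(2)[OF lim d(1)] by (auto simp: eventually_sequentially)
  have "\<exists>W. W \<in> \<C> \<and> y k \<in> W" for k
    using cov by blast
  then obtain V where V: "\<And>k. V k \<in> \<C> \<and> y k \<in> V k"
    by metis
  have "points A \<union> range y \<subseteq> \<Union>(\<D> \<union> V ` {..<m})"
  proof
    fix x assume "x \<in> points A \<union> range y"
    then consider "x \<in> points A" | k where "x = y k" "k < m" | k where "x = y k" "k \<ge> m"
      using not_le by blast
    then show "x \<in> \<Union>(\<D> \<union> V ` {..<m})"
    proof cases
      case 1
      then show ?thesis using \<D>(3) by blast
    next
      case 2
      then show ?thesis using V by blast
    next
      case 3
      then show ?thesis using m d(2) by blast
    qed
  qed
  moreover have "\<D> \<union> V ` {..<m} \<subseteq> \<C>" "finite (\<D> \<union> V ` {..<m})"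
    using \<D> V by auto
  ultimately show "\<exists>\<C>'\<subseteq>\<C>. finite \<C>' \<and> points A \<union> range y \<subseteq> \<Union>\<C>'"
    by blast
qed

section \<open>Iterates of the induced operator\<close>

definition orbit :: "('a::metric_space \<Rightarrow> 'a hyperspace) \<Rightarrow> nat \<Rightarrow> 'a \<Rightarrow> 'a hyperspace" where
  "orbit F n x = (induced F ^^ n) (Compact {x})"

lemma continuous_on_induced:
  assumes cont: "continuous_on UNIV F"
  shows "continuous_on UNIV (induced F)"
  unfolding continuous_on_iff
proof safe
  fix A :: "'a hyperspace" and e :: real
  assume e: "e > 0"
  obtain d where d: "d > 0"
    "\<And>x y. x \<in> points A \<Longrightarrow> dist x y < d \<Longrightarrow> dist (F x) (F y) < e/2"
    using continuous_uniform_near_compact[OF cont compact_points, of "e/2" A] e by auto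
  have "dist (induced F B) (induced F A) < e" if B: "dist B A < d" for B
  proof -
    have "infdist z (points (induced F A)) \<le> e/2" if z: "z \<in> points (induced F B)" for z
    proof -
      obtain b where b: "b \<in> points B" "z \<in> points (F b)"
        using z by (auto simp: points_induced[OF cont])
      have "infdist b (points A) < d"
        using infdist_points_le_dist[OF b(1), of A] B by linarith
      then obtain a where a: "a \<in> points A" "dist b a < d"
        by (auto simp: infdist_points_less_iff)
      have "infdist z (points (induced F A)) \<le> infdist z (points (F a))"
        using a by (intro infdist_mono) (auto simp: points_induced[OF cont])
      also have "\<dots> \<le> dist (F b) (F a)"
        by (rule infdist_points_le_dist[OF b(2)])
      also have "\<dots> \<le> e/2"
        using d(2)[of a b] a by (simp add: dist_commute)
      finally show ?thesis .
    qed
    moreover have "infdist z (points (induced F B)) \<le> e/2" if z: "z \<in> points (induced F A)" for z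
    proof -
      obtain a where a: "a \<in> points A" "z \<in> points (F a)"
        using z by (auto simp: points_induced[OF cont])
      have "infdist a (points B) < d"
        using infdist_points_le_dist[OF a(1), of B] B by (simp add: dist_commute)
      then obtain b where b: "b \<in> points B" "dist a b < d"
        by (auto simp: infdist_points_less_iff)
      have "infdist z (points (induced F B)) \<le> infdist z (points (F b))"
        using b by (intro infdist_mono) (auto simp: points_induced[OF cont])
      also have "\<dots> \<le> dist (F a) (F b)"
        by (rule infdist_points_le_dist[OF a(2)])
      also have "\<dots> \<le> e/2"
        using d(2)[of a b] a b by simp
      finally show ?thesis .
    qed
    ultimately have "dist (induced F B) (induced F A) \<le> e/2"
      unfolding dist_hyperspace_le_iff by blast
    then show ?thesis using e by linarith
  qed
  then show "\<exists>d>0. \<forall>B\<in>UNIV. dist B A < d \<longrightarrow> dist (induced F B) (induced F A) < e"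
    using d(1) by blast
qed

lemma continuous_on_induced_funpow:
  assumes cont: "continuous_on UNIV F"
  shows "continuous_on UNIV (induced F ^^ n)"
proof (induction n)
  case (Suc n)
  show ?case
    unfolding funpow.simps(2)
    by (rule continuous_on_compose[OF Suc continuous_on_subset[OF continuous_on_induced[OF cont]]])
       simp
qed simp

lemma dist_Compact_singleton [simp]: "dist (Compact {x}) (Compact {y}) = dist x y"
  by (simp add: dist_hyperspace_def hausdorff_dist_def points_Compact)

lemma continuous_on_orbit:
  assumes "continuous_on UNIV F"
  shows "continuous_on UNIV (orbit F n)"
proof -
  have "continuous_on UNIV (\<lambda>x::'a. Compact {x})"
    by (auto simp: continuous_on_iff)
  then show ?thesis
    unfolding orbit_def
    by (rule continuous_on_compose2[OF continuous_on_induced_funpow[OF assms, of n]]) simp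
qed

lemma points_induced_funpow:
  assumes cont: "continuous_on UNIV F"
  shows "points ((induced F ^^ n) A) = (\<Union>x\<in>points A. points (orbit F n x))"
proof (induction n)
  case 0
  show ?case by (simp add: orbit_def points_Compact)
next
  case (Suc n)
  then show ?case by (simp add: orbit_def points_induced[OF cont])
qed

lemma points_orbit_subset:
  assumes "continuous_on UNIV F" "x \<in> points ((induced F ^^ m) A)"
  shows "points (orbit F n x) \<subseteq> points ((induced F ^^ (n + m)) A)"
  using assms(2) points_induced_funpow[OF assms(1), of n "(induced F ^^ m) A"]
  by (auto simp: funpow_add)

lemma induced_funpow_fixed: "induced F A = A \<Longrightarrow> (induced F ^^ n) A = A"
  by (induction n) simp_all

section \<open>Strict attractors are invariant and attractive\<close>

lemma strict_attractor_funpow_tendsto: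
  assumes "strict_attractor F A"
  obtains d where "d > 0"
    "\<And>S. (\<And>x. x \<in> points S \<Longrightarrow> infdist x (points A) < d) \<Longrightarrow>
      (\<lambda>n. (induced F ^^ n) S) \<longlonglongrightarrow> A"
proof -
  obtain U where U: "open U" "points A \<subseteq> U"
    "\<And>S. points S \<subseteq> U \<Longrightarrow> (\<lambda>n. (induced F ^^ n) S) \<longlonglongrightarrow> A"
    using assms unfolding strict_attractor_def by blast
  show ?thesis
    using infdist_less_subset_open[OF U(1,2)] U(3) that by (metis subsetI)
qed

lemma strict_attractor_orbit_tendsto:
  assumes "strict_attractor F A" "x \<in> points A"
  shows "(\<lambda>n. orbit F n x) \<longlonglongrightarrow> A"
proof -
  have "points (Compact {x}) \<subseteq> points A"
    using assms(2) by (simp add: points_Compact)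
  then show ?thesis
    using assms(1) unfolding strict_attractor_def orbit_def by blast
qed

lemma strict_attractor_fixed:
  assumes cont: "continuous_on UNIV F" and attr: "strict_attractor F A"
  shows "induced F A = A"
proof (rule LIMSEQ_unique)
  have lim: "(\<lambda>n. (induced F ^^ n) A) \<longlonglongrightarrow> A"
    using attr unfolding strict_attractor_def by blast
  show "(\<lambda>n. (induced F ^^ Suc n) A) \<longlonglongrightarrow> A"
    by (rule LIMSEQ_Suc[OF lim])
  show "(\<lambda>n. (induced F ^^ Suc n) A) \<longlonglongrightarrow> induced F A"
    using continuous_on_tendsto_compose[OF continuous_on_induced[OF cont] lim] by simp
qed

lemma strict_attractor_attractive:
  assumes "strict_attractor F A"
  shows "attractive F A"
proof -
  obtain d where d: "d > 0"
    "\<And>S. (\<And>x. x \<in> points S \<Longrightarrow> infdist x (points A) < d) \<Longrightarrow>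
      (\<lambda>n. (induced F ^^ n) S) \<longlonglongrightarrow> A"
    using strict_attractor_funpow_tendsto[OF assms] by blast
  have "(\<lambda>n. dist ((induced F ^^ n) B) A) \<longlonglongrightarrow> 0" if "B \<in> ball A d" for B
  proof -
    have "infdist x (points A) < d" if "x \<in> points B" for x
      using infdist_points_le_dist[OF that, of A] \<open>B \<in> ball A d\<close> by (simp add: dist_commute)
    then show ?thesis
      by (simp add: d(2) flip: tendsto_dist_iff)
  qed
  with d(1) show ?thesis
    unfolding attractive_def by (metis centre_in_ball open_ball)
qed

section \<open>Stability of strict attractors\<close>

lemma attractor_upper_stable_one_iterate:
  assumes cont: "continuous_on UNIV F" and fixed: "induced F A = A" and e: "e > 0"
  obtains d where "d > 0"
    "\<And>x z. infdist x (points A) < d \<Longrightarrow> z \<in> points (orbit F n x) \<Longrightarrow> infdist z (points A) < e"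
proof -
  obtain d where d: "d > 0"
    "\<And>a x. a \<in> points A \<Longrightarrow> dist a x < d \<Longrightarrow> dist (orbit F n a) (orbit F n x) < e"
    using continuous_uniform_near_compact[OF continuous_on_orbit[OF cont] compact_points e]
    by blast
  have "infdist z (points A) < e"
    if x: "infdist x (points A) < d" and z: "z \<in> points (orbit F n x)" for x z
  proof -
    obtain a where a: "a \<in> points A" "dist x a < d"
      using x by (auto simp: infdist_points_less_iff)
    have "points (orbit F n a) \<subseteq> points A"
      using points_orbit_subset[OF cont, of a 0 A n] a(1) induced_funpow_fixed[OF fixed] by simp
    then have "infdist z (points A) \<le> infdist z (points (orbit F n a))"
      by (intro infdist_mono) auto
    also have "\<dots> \<le> dist (orbit F n x) (orbit F n a)"
      by (rule infdist_points_le_dist[OF z])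
    also have "\<dots> < e"
      using d(2)[of a x] a by (simp add: dist_commute)
    finally show ?thesis .
  qed
  with d(1) that show ?thesis by blast
qed

text \<open>Points \<open>y k\<close> approaching \<open>A\<close> are collected, together with \<open>A\<close>, in one compact set \<open>S\<close>; the
  attractor property of \<open>S\<close> controls all late iterates of all \<open>y k\<close> at once.\<close>

lemma attractor_upper_stable:
  assumes cont: "continuous_on UNIV F" and attr: "strict_attractor F A" and e: "e > 0"
  obtains d where "d > 0"
    "\<And>x n z. infdist x (points A) < d \<Longrightarrow> z \<in> points (orbit F n x) \<Longrightarrow> infdist z (points A) < e"
proof (rule ccontr)
  assume no: "\<not> thesis"
  have fixed: "induced F A = A"
    by (rule strict_attractor_fixed[OF cont attr])
  obtain r where r: "r > 0"
    "\<And>S. (\<And>x. x \<in> points S \<Longrightarrow> infdist x (points A) < r) \<Longrightarrow>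
      (\<lambda>n. (induced F ^^ n) S) \<longlonglongrightarrow> A"
    using strict_attractor_funpow_tendsto[OF attr] by blast
  have "\<exists>x n z. infdist x (points A) < min r (inverse (real (Suc k))) \<and>
      z \<in> points (orbit F n x) \<and> \<not> infdist z (points A) < e" for k
    using no that[of "min r (inverse (real (Suc k)))"] r(1) by fastforce
  then obtain y n z where y: "\<And>k. infdist (y k) (points A) < min r (inverse (real (Suc k)))"
    and z: "\<And>k. z k \<in> points (orbit F (n k) (y k))" "\<And>k. \<not> infdist (z k) (points A) < e"
    by metis
  have y0: "(\<lambda>k. infdist (y k) (points A)) \<longlonglongrightarrow> 0"
    by (rule Lim_null_comparison[OF _ LIMSEQ_inverse_real_of_nat])
       (use y in \<open>auto intro!: always_eventually less_imp_le simp: infdist_nonneg\<close>)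
  define S where "S = Compact (points A \<union> range y)"
  have S: "points S = points A \<union> range y"
    unfolding S_def by (rule points_Compact) (use compact_Un_range_approaching[OF y0] in auto)
  have "(\<lambda>n. (induced F ^^ n) S) \<longlonglongrightarrow> A"
    by (rule r(2)) (use S y r(1) in auto)
  then obtain N where N: "\<And>m. m \<ge> N \<Longrightarrow> dist ((induced F ^^ m) S) A < e"
    using e unfolding lim_sequentially by blast
  have n_less: "n k < N" for k
  proof (rule ccontr)
    assume "\<not> n k < N"
    moreover have "z k \<in> points ((induced F ^^ n k) S)"
      using z(1)[of k] by (auto simp: points_induced_funpow[OF cont] S)
    ultimately show False
      using infdist_points_le_dist[of "z k" "(induced F ^^ n k) S" A] N[of "n k"] z(2)[of k] by simp
  qed
  have "\<forall>\<^sub>F k in sequentially. \<forall>w\<in>points (orbit F m (y k)). infdist w (points A) < e" for m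
  proof -
    obtain d where d: "d > 0"
      "\<And>x w. infdist x (points A) < d \<Longrightarrow> w \<in> points (orbit F m x) \<Longrightarrow> infdist w (points A) < e"
      using attractor_upper_stable_one_iterate[OF cont fixed e] by blast
    show ?thesis
      using order_tendstoD(2)[OF y0 d(1)] by eventually_elim (use d(2) in blast)
  qed
  then have "\<forall>\<^sub>F k in sequentially. \<forall>m\<in>{..<N}.
      \<forall>w\<in>points (orbit F m (y k)). infdist w (points A) < e"
    by (intro eventually_ball_finite) auto
  then obtain k where "\<forall>m<N. \<forall>w\<in>points (orbit F m (y k)). infdist w (points A) < e"
    unfolding eventually_sequentially by auto
  then show False
    using n_less[of k] z[of k] by blast
qed

text \<open>The closed sets \<open>{x \<in> A. \<forall>n\<ge>N. dist (orbit F n x) A \<le> e}\<close> exhaust the compact set \<open>A\<close>,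
  so by Baire's theorem one of them contains a relative ball of \<open>A\<close>.\<close>

lemma attractor_uniform_on_ball:
  assumes cont: "continuous_on UNIV F" and attr: "strict_attractor F A" and e: "e > 0"
  obtains w r N where "w \<in> points A" "r > 0"
    "\<And>x n. x \<in> points A \<Longrightarrow> dist w x < r \<Longrightarrow> n \<ge> N \<Longrightarrow> dist (orbit F n x) A \<le> e"
proof -
  define T where "T N = {x \<in> points A. \<forall>n\<ge>N. dist (orbit F n x) A \<le> e}" for N :: nat
  let ?X = "top_of_set (points A)"
  have closed: "closedin ?X (T N)" for N
  proof -
    have "closed {x. dist (orbit F n x) A \<le> e}" for n
      by (intro closed_Collect_le continuous_intros continuous_on_orbit cont)
    moreover have "T N = points A \<inter> (\<Inter>n\<in>{N..}. {x. dist (orbit F n x) A \<le> e})"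
      by (auto simp: T_def)
    ultimately show ?thesis
      by (simp add: closedin_closed_Int closed_INT)
  qed
  have cover: "(\<Union>N. T N) = points A"
  proof safe
    fix x assume x: "x \<in> points A"
    obtain N where "\<forall>n\<ge>N. dist (orbit F n x) A < e"
      using strict_attractor_orbit_tendsto[OF attr x] e unfolding lim_sequentially by blast
    then show "x \<in> (\<Union>N. T N)"
      using x by (auto simp: T_def intro: less_imp_le)
  qed (auto simp: T_def)
  have "\<exists>N. ?X interior_of T N \<noteq> {}"
  proof (rule ccontr)
    assume none: "\<nexists>N. ?X interior_of T N \<noteq> {}"
    have compact: "compact_space ?X"
      by (simp add: compact_space_subtopology)
    then have "locally_compact_space ?X \<and> regular_space ?X"
      by (simp add: compact_imp_locally_compact_space compact_Hausdorff_imp_regular_space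
          Hausdorff_space_subtopology)
    then have "?X interior_of \<Union>(range T) = {}"
      by (intro Baire_category_alt disjI2) (use closed none in auto)
    then show False
      using cover interior_of_topspace[of ?X] points_nonempty[of A] by simp
  qed
  then obtain N w where w: "w \<in> ?X interior_of T N"
    by blast
  have "openin ?X (?X interior_of T N)" by simp
  then obtain r where r: "r > 0" "\<And>x. x \<in> points A \<Longrightarrow> dist x w < r \<Longrightarrow> x \<in> ?X interior_of T N"
    using w unfolding openin_euclidean_subtopology_iff by blast
  show ?thesis
  proof (rule that[OF _ r(1)])
    show "w \<in> points A"
      using w interior_of_subset[of ?X "T N"] by (auto simp: T_def)
    show "dist (orbit F n x) A \<le> e" if "x \<in> points A" "dist w x < r" "n \<ge> N" for x n
      using r(2)[of x] that interior_of_subset[of ?X "T N"] by (auto simp: T_def dist_commute)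
  qed
qed

text \<open>Every orbit starting in \<open>A\<close> visits the ball of uniform behaviour, and by compactness it does
  so within a bounded time \<open>L\<close>; from there on it has had at least \<open>N\<close> steps at time \<open>N + L\<close>.\<close>

lemma attractor_lower_uniform:
  assumes cont: "continuous_on UNIV F" and attr: "strict_attractor F A" and e: "e > 0"
  obtains M where
    "\<And>x a. x \<in> points A \<Longrightarrow> a \<in> points A \<Longrightarrow> infdist a (points (orbit F M x)) \<le> e"
proof -
  have fixed: "induced F A = A"
    by (rule strict_attractor_fixed[OF cont attr])
  obtain w r N where w: "w \<in> points A" and r: "r > 0"
    "\<And>x n. x \<in> points A \<Longrightarrow> dist w x < r \<Longrightarrow> n \<ge> N \<Longrightarrow> dist (orbit F n x) A \<le> e"
    using attractor_uniform_on_ball[OF cont attr e] by blast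
  define H where "H m = {x. dist (orbit F m x) A < r}" for m
  have "open (H m)" for m
    unfolding H_def by (intro open_Collect_less continuous_intros continuous_on_orbit cont)
  moreover have "points A \<subseteq> (\<Union>m. H m)"
  proof
    fix x assume "x \<in> points A"
    then show "x \<in> (\<Union>m. H m)"
      using strict_attractor_orbit_tendsto[OF attr] r(1) unfolding lim_sequentially H_def by blast
  qed
  ultimately obtain I where I: "finite I" "points A \<subseteq> (\<Union>m\<in>I. H m)"
    using compactE_image[OF compact_points[of A], of UNIV H] by metis
  define L where "L = Max (insert 0 I)"
  show ?thesis
  proof (rule that)
    fix x a assume x: "x \<in> points A" and a: "a \<in> points A"
    obtain m where m: "m \<in> I" "dist (orbit F m x) A < r"
      using I(2) x by (auto simp: H_def)
    have "m \<le> L"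
      unfolding L_def using I(1) m(1) by simp
    have "infdist w (points (orbit F m x)) < r"
      using infdist_points_le_dist[OF w, of "orbit F m x"] m(2) by (simp add: dist_commute)
    then obtain y where y: "y \<in> points (orbit F m x)" "dist w y < r"
      by (auto simp: infdist_points_less_iff)
    have "y \<in> points A"
      using points_orbit_subset[OF cont, of x 0 A m] x y(1) induced_funpow_fixed[OF fixed] by auto
    define k where "k = N + L - m"
    have k: "k \<ge> N" "k + m = N + L"
      using \<open>m \<le> L\<close> by (simp_all add: k_def)
    have "points (orbit F k y) \<subseteq> points (orbit F (N + L) x)"
      using points_orbit_subset[OF cont, of y m "Compact {x}" k] y(1) k(2) by (simp add: orbit_def)
    then have "infdist a (points (orbit F (N + L) x)) \<le> infdist a (points (orbit F k y))"
      by (intro infdist_mono) auto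
    also have "\<dots> \<le> dist (orbit F k y) A"
      using infdist_points_le_dist[OF a, of "orbit F k y"] by (simp add: dist_commute)
    also have "\<dots> \<le> e"
      using r(2)[OF \<open>y \<in> points A\<close> y(2) k(1)] .
    finally show "infdist a (points (orbit F (N + L) x)) \<le> e" .
  qed
qed

lemma strict_attractor_stable:
  assumes cont: "continuous_on UNIV F" and attr: "strict_attractor F A"
  shows "stable F A"
  unfolding stable_def
proof (intro allI impI)
  fix e :: real assume e: "e > 0"
  have fixed: "induced F A = A"
    by (rule strict_attractor_fixed[OF cont attr])
  obtain M where M:
    "\<And>x a. x \<in> points A \<Longrightarrow> a \<in> points A \<Longrightarrow> infdist a (points (orbit F M x)) \<le> e/4"
    using attractor_lower_uniform[OF cont attr, of "e/4"] e by auto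
  obtain d1 where d1: "d1 > 0"
    "\<And>x y. x \<in> points A \<Longrightarrow> dist x y < d1 \<Longrightarrow> dist (orbit F M x) (orbit F M y) < e/4"
    using continuous_uniform_near_compact[OF continuous_on_orbit[OF cont] compact_points, of "e/4" A]
      e by auto
  have "min d1 (e/2) > 0"
    using d1(1) e by simp
  then obtain d2 where d2: "d2 > 0"
    "\<And>x n z. infdist x (points A) < d2 \<Longrightarrow> z \<in> points (orbit F n x) \<Longrightarrow>
      infdist z (points A) < min d1 (e/2)"
    using attractor_upper_stable[OF cont attr] by metis
  have "\<forall>\<^sub>F B in nhds A. dist ((induced F ^^ n) B) A < e" for n
  proof -
    have "((induced F ^^ n) \<longlongrightarrow> A) (nhds A)"
      using continuous_on_tendsto_compose
        [OF continuous_on_induced_funpow[OF cont, of n] filterlim_ident, of A]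
        induced_funpow_fixed[OF fixed, of n] by simp
    then show ?thesis
      using e by (rule tendstoD)
  qed
  then have "\<forall>\<^sub>F B in nhds A. \<forall>n\<in>{..<M}. dist ((induced F ^^ n) B) A < e"
    by (intro eventually_ball_finite) auto
  then obtain d3 where d3: "d3 > 0"
    "\<And>B n. dist B A < d3 \<Longrightarrow> n < M \<Longrightarrow> dist ((induced F ^^ n) B) A < e"
    unfolding eventually_nhds_metric by auto
  have "dist ((induced F ^^ n) B) A < e" if B: "dist B A < min d2 d3" for n B
  proof (cases "n < M")
    case True
    then show ?thesis using d3(2) B by simp
  next
    case False
    have near: "infdist z (points A) < min d1 (e/2)" if z: "z \<in> points ((induced F ^^ k) B)" for z k
    proof -
      obtain b where b: "b \<in> points B" "z \<in> points (orbit F k b)"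
        using z by (auto simp: points_induced_funpow[OF cont])
      then show ?thesis
        using d2(2)[of b z k] infdist_points_le_dist[OF b(1), of A] B by simp
    qed
    \<comment> \<open>A single point \<open>y\<close> near \<open>A\<close> at time \<open>n - M\<close> already spreads over \<open>A\<close> by time \<open>n\<close>.\<close>
    obtain y where y: "y \<in> points ((induced F ^^ (n - M)) B)"
      using points_nonempty by blast
    have "infdist y (points A) < d1"
      using near[OF y] by simp
    then obtain x where x: "x \<in> points A" "dist y x < d1"
      by (auto simp: infdist_points_less_iff)
    have sub: "points (orbit F M y) \<subseteq> points ((induced F ^^ n) B)"
      using points_orbit_subset[OF cont y, of M] False by simp
    have "infdist a (points ((induced F ^^ n) B)) \<le> e/2" if a: "a \<in> points A" for a
    proof -
      have "infdist a (points ((induced F ^^ n) B)) \<le> infdist a (points (orbit F M y))"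
        using sub by (intro infdist_mono) auto
      also have "\<dots> \<le> infdist a (points (orbit F M x)) + dist (orbit F M x) (orbit F M y)"
        by (rule infdist_points_triangle)
      also have "\<dots> \<le> e/4 + e/4"
        using M[OF x(1) a] d1(2)[of x y] x by (intro add_mono) (auto simp: dist_commute)
      finally show ?thesis by simp
    qed
    moreover have "infdist z (points A) \<le> e/2" if "z \<in> points ((induced F ^^ n) B)" for z
      using near[OF that] by simp
    ultimately have "dist ((induced F ^^ n) B) A \<le> e/2"
      unfolding dist_hyperspace_le_iff by blast
    then show ?thesis using e by linarith
  qed
  with d2(1) d3(1) show "\<exists>\<delta>>0. \<forall>n B. dist B A < \<delta> \<longrightarrow> dist ((induced F ^^ n) B) A < e"
    by (intro exI[of _ "min d2 d3"]) auto
qed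

theorem corollary1:
  fixes F :: "'a::metric_space \<Rightarrow> 'a hyperspace" and A :: "'a hyperspace"
  assumes "continuous_on UNIV F"
    and "strict_attractor F A"
  shows "induced F A = A \<and> asymptotically_stable F A"
  using strict_attractor_fixed[OF assms] strict_attractor_stable[OF assms]
    strict_attractor_attractive[OF assms(2)]
  by (simp add: asymptotically_stable_def)

end
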